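(* Let $j$ be a positive integer and let $c^{(j)}\in l_\infty(\mathbb{Z})$. Let $\alpha,\gamma\in l_1(\mathbb{Z})$ be masks satisfying $$\sum_{k\in\mathbb{Z}}\alpha_{2k}=\sum_{k\in\mathbb{Z}}\alpha_{2k+1}=\sum_{k\in\mathbb{Z}}\gamma_k=1$$ and $$\sum_{k\in\mathbb{Z}}|\alpha_k|\,|k|=K_\alpha<\infty,\qquad 2\sum_{k\in\mathbb{Z}}|\gamma_k|\,|k|=K_\gamma<\infty .$$ Define, for $1\le\ell\le j$, $$c^{(\ell-1)}:=\gamma*(c^{(\ell)}\downarrow 2),\qquad d^{(\ell)}:=c^{(\ell)}-\mathcal{S}_\alpha c^{(\ell-1)} .$$ Then $$\|d^{(\ell)}\|_\infty\le K_{\alpha,\gamma}\,\|\Delta c^{(\ell)}\|_\infty,\qquad 1\le\ell\le j,$$ with $K_{\alpha,\gamma}:=K_\gamma\|\alpha\|_1+K_\alpha\|\gamma\|_1$. In particular, if $\|\Delta c^{(j)}\|_\infty\le K\cdot 2^{-j}$ for some $K$ independent of $j$, then $$\|d^{(\ell)}\|_\infty\le\left(K\cdot K_{\alpha,\gamma}\cdot\|\gamma\|_1^{j}\right)\cdot(2\|\gamma\|_1)^{-\ell},\qquad 1\le\ell\le j .$$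
   Context: Sequences are real-valued and indexed by $\mathbb{Z}$. The difference operator is $(\Delta c)_k:=c_{k+1}-c_k$; downsampling is $(c\downarrow 2)_k:=c_{2k}$; convolution of $\gamma\in l_1(\mathbb{Z})$ and $c\in l_\infty(\mathbb{Z})$ is $(\gamma*c)_k:=\sum_{\ell\in\mathbb{Z}}\gamma_\ell c_{k-\ell}$; the subdivision operator is $(\mathcal{S}_\alpha c)_k:=\sum_{\ell\in\mathbb{Z}}\alpha_{k-2\ell}c_\ell$ for $c\in l_\infty(\mathbb{Z})$. $\|\cdot\|_1$ and $\|\cdot\|_\infty$ are the $l_1$ and $l_\infty$ norms. *)

theory Defs
  imports "HOL-Analysis.Analysis"
begin

type_synonym bi_seq = "int \<Rightarrow> real"

definition l1 :: "bi_seq set" where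
  "l1 = {c. (\<lambda>k. \<bar>c k\<bar>) summable_on UNIV}"

definition linf :: "bi_seq set" where
  "linf = {c. bounded (range c)}"

text \<open>The two norms are meaningful only on the corresponding space: outside it
  \<open>infsum\<close> defaults to 0 and the real \<open>SUP\<close> is unspecified.\<close>

definition l1_norm :: "bi_seq \<Rightarrow> real" where
  "l1_norm c = (\<Sum>\<^sub>\<infinity>k. \<bar>c k\<bar>)"

definition linf_norm :: "bi_seq \<Rightarrow> real" where
  "linf_norm c = (SUP k. \<bar>c k\<bar>)"

definition diff_op :: "bi_seq \<Rightarrow> bi_seq" where
  "diff_op c k = c (k + 1) - c k"

definition downsample :: "bi_seq \<Rightarrow> bi_seq" where
  "downsample c k = c (2 * k)"

definition conv :: "bi_seq \<Rightarrow> bi_seq \<Rightarrow> bi_seq" where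
  "conv \<gamma> c k = (\<Sum>\<^sub>\<infinity>l. \<gamma> l * c (k - l))"

definition subdiv :: "bi_seq \<Rightarrow> bi_seq \<Rightarrow> bi_seq" where
  "subdiv \<alpha> c k = (\<Sum>\<^sub>\<infinity>l. \<alpha> (k - 2 * l) * c l)"

end

theory Submission
  imports Defs
begin

text \<open>
  Because the even and the odd entries of \<open>\<alpha>\<close> and the entries of \<open>\<gamma>\<close> each sum to one, both
  \<open>subdiv \<alpha>\<close> and \<open>conv \<gamma>\<close> form averages with weights of total mass one.  The detail
  \<open>d\<^sub>k = c\<^sub>k - (S\<^sub>\<alpha> (\<gamma> * (c \<down> 2)))\<^sub>k\<close> is therefore the deviation of the constant \<open>c\<^sub>k\<close> from an
  iterated average of the values \<open>c\<^bsub>2l - 2m\<^esub>\<close>, weighted by \<open>\<alpha>\<^bsub>k - 2l\<^esub> \<gamma>\<^sub>m\<close>.  A sequence is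
  Lipschitz with constant \<open>D = \<parallel>\<Delta>c\<parallel>\<^sub>\<infinity>\<close> (\<open>abs_diff_le_linf_norm_diff_op\<close>), so
  \<open>|c\<^sub>k - c\<^bsub>2l - 2m\<^esub>| \<le> (|k - 2l| + 2|m|) D\<close>, and the first moments of \<open>\<alpha>\<close> and \<open>\<gamma>\<close> are
  exactly what is needed to sum this bound.  The single estimate \<open>average_deviation_bound\<close>,
  applied once to \<open>\<gamma>\<close> and once to a coset of \<open>\<alpha>\<close>, carries the first claim
  (\<open>detail_abs_le\<close>).

  For the second claim, a difference of the coarser sequence is a \<open>\<gamma>\<close>-weighted sum of differences
  of \<open>c\<close> over distance two, whence \<open>\<parallel>\<Delta>(\<gamma> * (c \<down> 2))\<parallel>\<^sub>\<infinity> \<le> 2 \<parallel>\<gamma>\<parallel>\<^sub>1 \<parallel>\<Delta>c\<parallel>\<^sub>\<infinity>\<close>.  Descending from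
  level \<open>j\<close> to level \<open>l\<close> costs the factor \<open>(2 \<parallel>\<gamma>\<parallel>\<^sub>1)\<^bsup>j - l\<^esup>\<close>
  (\<open>pyramid_linf_norm_diff_op_le\<close>); splitting it as \<open>(2 \<parallel>\<gamma>\<parallel>\<^sub>1)\<^bsup>j\<^esup> (2 \<parallel>\<gamma>\<parallel>\<^sub>1)\<^bsup>-l\<^esup>\<close> shows that the assumed
  decay \<open>2\<^bsup>-j\<^esup>\<close> cancels the powers of two belonging to \<open>j\<close> and leaves \<open>\<parallel>\<gamma>\<parallel>\<^sub>1\<^bsup>j\<^esup>\<close>.
\<close>

section \<open>Bounded sequences and their differences\<close>

lemma abs_le_linf_norm:
  assumes "c \<in> linf"
  shows "\<bar>c k\<bar> \<le> linf_norm c"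
proof -
  obtain B where B: "\<And>k. \<bar>c k\<bar> \<le> B"
    using assms by (auto simp: linf_def bounded_iff)
  show ?thesis
    unfolding linf_norm_def by (rule cSUP_upper) (auto intro!: bdd_aboveI2[where M = B] B)
qed

lemma linf_norm_nonneg: "c \<in> linf \<Longrightarrow> 0 \<le> linf_norm c"
  using abs_le_linf_norm[of c 0] abs_ge_zero order_trans by blast

lemma linfI: "(\<And>k. \<bar>c k\<bar> \<le> B) \<Longrightarrow> c \<in> linf"
  by (auto simp: linf_def bounded_iff)

lemma linf_norm_le: "(\<And>k. \<bar>c k\<bar> \<le> B) \<Longrightarrow> linf_norm c \<le> B"
  unfolding linf_norm_def by (rule cSUP_least) auto

lemma diff_op_in_linf:
  assumes "c \<in> linf"
  shows "diff_op c \<in> linf"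
proof (rule linfI)
  fix k
  show "\<bar>diff_op c k\<bar> \<le> 2 * linf_norm c"
    using abs_le_linf_norm[OF assms, of k] abs_le_linf_norm[OF assms, of "k + 1"]
    by (simp add: diff_op_def)
qed

lemma downsample_in_linf: "c \<in> linf \<Longrightarrow> downsample c \<in> linf"
  by (auto simp: linf_def bounded_iff downsample_def)

text \<open>Telescoping: going from \<open>n\<close> to \<open>m\<close> takes \<open>|m - n|\<close> unit steps.\<close>

lemma abs_diff_le_linf_norm_diff_op:
  assumes "c \<in> linf"
  shows "\<bar>c m - c n\<bar> \<le> real_of_int \<bar>m - n\<bar> * linf_norm (diff_op c)"
proof -
  let ?D = "linf_norm (diff_op c)"
  have forward: "\<bar>c (p + int i) - c p\<bar> \<le> real i * ?D" for p i
  proof (induction i)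
    case (Suc i)
    have "\<bar>c (p + int i + 1) - c (p + int i)\<bar> \<le> ?D"
      using abs_le_linf_norm[OF diff_op_in_linf[OF assms], of "p + int i"]
      by (simp add: diff_op_def)
    with Suc show ?case
      by (simp add: algebra_simps)
  qed simp
  show ?thesis
  proof (cases "n \<le> m")
    case True
    then show ?thesis using forward[of n "nat (m - n)"] by simp
  next
    case False
    then show ?thesis using forward[of m "nat (n - m)"] by (simp add: abs_minus_commute)
  qed
qed

section \<open>Weighted sums and averages\<close>

lemma weighted_sum_bound:
  fixes w x B :: "'a \<Rightarrow> real"
  assumes "(\<lambda>i. \<bar>w i\<bar> * B i) summable_on A" and bound: "\<And>i. i \<in> A \<Longrightarrow> \<bar>x i\<bar> \<le> B i"
  shows "(\<lambda>i. w i * x i) summable_on A"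
    and "\<bar>\<Sum>\<^sub>\<infinity>i\<in>A. w i * x i\<bar> \<le> (\<Sum>\<^sub>\<infinity>i\<in>A. \<bar>w i\<bar> * B i)"
proof -
  have le: "norm (w i * x i) \<le> \<bar>w i\<bar> * B i" if "i \<in> A" for i
    using bound[OF that] by (simp add: abs_mult mult_left_mono)
  have abs: "(\<lambda>i. norm (w i * x i)) summable_on A"
    by (rule Infinite_Sum.abs_summable_on_comparison_test') (use assms(1) le in auto)
  then show "(\<lambda>i. w i * x i) summable_on A"
    by (rule abs_summable_summable)
  have "norm (\<Sum>\<^sub>\<infinity>i\<in>A. w i * x i) \<le> (\<Sum>\<^sub>\<infinity>i\<in>A. norm (w i * x i))"
    using abs by (rule norm_infsum_bound)
  also have "\<dots> \<le> (\<Sum>\<^sub>\<infinity>i\<in>A. \<bar>w i\<bar> * B i)"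
    by (rule infsum_mono) (use abs assms(1) le in auto)
  finally show "\<bar>\<Sum>\<^sub>\<infinity>i\<in>A. w i * x i\<bar> \<le> (\<Sum>\<^sub>\<infinity>i\<in>A. \<bar>w i\<bar> * B i)"
    by simp
qed

text \<open>Weights of total mass one reproduce the constant \<open>y\<close>, so the deviation of the average from
  \<open>y\<close> is the weighted sum of the deviations \<open>x i - y\<close>.  The weights may have either sign, which is
  why absolute values appear on the right.\<close>

lemma average_deviation_bound:
  fixes w x B :: "'a \<Rightarrow> real"
  assumes w: "w summable_on A" "(\<Sum>\<^sub>\<infinity>i\<in>A. w i) = 1"
    and wB: "(\<lambda>i. \<bar>w i\<bar> * B i) summable_on A"
    and bound: "\<And>i. i \<in> A \<Longrightarrow> \<bar>y - x i\<bar> \<le> B i"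
  shows "\<bar>y - (\<Sum>\<^sub>\<infinity>i\<in>A. w i * x i)\<bar> \<le> (\<Sum>\<^sub>\<infinity>i\<in>A. \<bar>w i\<bar> * B i)"
proof -
  have bound': "\<bar>x i - y\<bar> \<le> B i" if "i \<in> A" for i
    using bound[OF that] by (simp add: abs_minus_commute)
  have dev: "(\<lambda>i. w i * (x i - y)) summable_on A"
    by (rule weighted_sum_bound(1)[OF wB bound'])
  have "(\<Sum>\<^sub>\<infinity>i\<in>A. w i * x i) = (\<Sum>\<^sub>\<infinity>i\<in>A. w i * y + w i * (x i - y))"
    by (simp add: algebra_simps)
  also have "\<dots> = (\<Sum>\<^sub>\<infinity>i\<in>A. w i * y) + (\<Sum>\<^sub>\<infinity>i\<in>A. w i * (x i - y))"
    by (rule infsum_add[OF summable_on_cmult_left[OF w(1)] dev])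
  also have "(\<Sum>\<^sub>\<infinity>i\<in>A. w i * y) = y"
    using infsum_cmult_left[of y w A] w by simp
  finally have "\<bar>y - (\<Sum>\<^sub>\<infinity>i\<in>A. w i * x i)\<bar> = \<bar>\<Sum>\<^sub>\<infinity>i\<in>A. w i * (x i - y)\<bar>"
    by simp
  then show ?thesis
    using weighted_sum_bound(2)[OF wB bound'] by simp
qed

section \<open>Passing to the coarser sequence\<close>

lemma conv_summable:
  assumes "\<gamma> \<in> l1" "a \<in> linf"
  shows "(\<lambda>l. \<gamma> l * a (k - l)) summable_on UNIV"
  by (rule weighted_sum_bound(1)[where B = "\<lambda>_. linf_norm a"])
     (use assms abs_le_linf_norm in \<open>auto simp: l1_def intro: summable_on_cmult_left\<close>)

text \<open>The bound \<open>B\<close> is arbitrary because two values are used: \<open>linf_norm a\<close> to see that \<open>conv \<gamma> a\<close> is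
  bounded, and \<open>2 * linf_norm (diff_op c)\<close> when \<open>a\<close> is the difference of \<open>downsample c\<close>.\<close>

lemma conv_abs_le:
  assumes "\<gamma> \<in> l1" and "\<And>k. \<bar>a k\<bar> \<le> B"
  shows "\<bar>conv \<gamma> a k\<bar> \<le> l1_norm \<gamma> * B"
proof -
  have "\<bar>conv \<gamma> a k\<bar> \<le> (\<Sum>\<^sub>\<infinity>l. \<bar>\<gamma> l\<bar> * B)"
    unfolding conv_def
    by (rule weighted_sum_bound(2)) (use assms in \<open>auto simp: l1_def intro: summable_on_cmult_left\<close>)
  then show ?thesis
    using assms(1) by (simp add: infsum_cmult_left l1_def l1_norm_def)
qed

lemma conv_in_linf: "\<gamma> \<in> l1 \<Longrightarrow> a \<in> linf \<Longrightarrow> conv \<gamma> a \<in> linf"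
  by (rule linfI[OF conv_abs_le[OF _ abs_le_linf_norm]])

lemma diff_op_conv:
  assumes "\<gamma> \<in> l1" "a \<in> linf"
  shows "diff_op (conv \<gamma> a) = conv \<gamma> (diff_op a)"
proof
  fix k
  have "conv \<gamma> a (k + 1) = (\<Sum>\<^sub>\<infinity>l. \<gamma> l * a (k - l) + \<gamma> l * diff_op a (k - l))"
    by (simp add: conv_def diff_op_def algebra_simps)
  also have "\<dots> = conv \<gamma> a k + conv \<gamma> (diff_op a) k"
    unfolding conv_def by (intro infsum_add conv_summable diff_op_in_linf assms)
  finally show "diff_op (conv \<gamma> a) k = conv \<gamma> (diff_op a) k"
    by (simp add: diff_op_def)
qed

text \<open>One step of \<open>downsample c\<close> is two steps of \<open>c\<close>; this is the source of the factor two.\<close>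

lemma linf_norm_diff_op_coarsen_le:
  assumes "\<gamma> \<in> l1" "c \<in> linf"
  shows "linf_norm (diff_op (conv \<gamma> (downsample c))) \<le> 2 * l1_norm \<gamma> * linf_norm (diff_op c)"
proof (rule linf_norm_le)
  fix k
  have "\<bar>diff_op (downsample c) i\<bar> \<le> 2 * linf_norm (diff_op c)" for i
    using abs_diff_le_linf_norm_diff_op[OF assms(2), of "2 * (i + 1)" "2 * i"]
    by (simp add: diff_op_def downsample_def)
  from conv_abs_le[OF assms(1) this]
  show "\<bar>diff_op (conv \<gamma> (downsample c)) k\<bar> \<le> 2 * l1_norm \<gamma> * linf_norm (diff_op c)"
    by (simp add: diff_op_conv[OF assms(1) downsample_in_linf[OF assms(2)]] algebra_simps)
qed

section \<open>The size of the details\<close>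

text \<open>The indices \<open>k - 2l\<close> run through the residue class of \<open>k\<close> modulo two, hence the coefficients
  used by \<open>subdiv \<alpha>\<close> at \<open>k\<close> are either all the even or all the odd entries of \<open>\<alpha>\<close>.\<close>

lemma infsum_coset_eq_1:
  fixes \<alpha> :: bi_seq
  assumes "(\<Sum>\<^sub>\<infinity>k. \<alpha> (2 * k)) = 1" "(\<Sum>\<^sub>\<infinity>k. \<alpha> (2 * k + 1)) = 1"
  shows "(\<Sum>\<^sub>\<infinity>l. \<alpha> (k - 2 * l)) = 1"
proof -
  have bij: "bij_betw (\<lambda>l. k div 2 - l) UNIV UNIV"
    by (rule bij_betwI[where g = "\<lambda>l. k div 2 - l"]) auto
  have "(\<Sum>\<^sub>\<infinity>l. \<alpha> (k - 2 * l)) = (\<Sum>\<^sub>\<infinity>l. \<alpha> (2 * (k div 2 - l) + k mod 2))"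
    by (rule infsum_cong, rule arg_cong[of _ _ \<alpha>]) presburger
  also have "\<dots> = (\<Sum>\<^sub>\<infinity>l. \<alpha> (2 * l + k mod 2))"
    by (rule infsum_reindex_bij_betw[OF bij])
  also have "\<dots> = 1"
  proof (cases "even k")
    case True
    then have "k mod 2 = 0" by presburger
    with assms(1) show ?thesis by simp
  next
    case False
    then have "k mod 2 = 1" by presburger
    with assms(2) show ?thesis by simp
  qed
  finally show ?thesis .
qed

lemma
  fixes f :: "int \<Rightarrow> real"
  assumes "f summable_on UNIV"
  shows summable_on_coset: "(\<lambda>l. f (k - 2 * l)) summable_on UNIV"
    and infsum_coset_le: "(\<And>i. 0 \<le> f i) \<Longrightarrow> (\<Sum>\<^sub>\<infinity>l. f (k - 2 * l)) \<le> (\<Sum>\<^sub>\<infinity>i. f i)"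
proof -
  let ?h = "\<lambda>l. k - 2 * l"
  have inj: "inj ?h" by (simp add: inj_def)
  have sub: "f summable_on range ?h"
    using assms by (rule summable_on_subset_banach) simp
  then show "(\<lambda>l. f (k - 2 * l)) summable_on UNIV"
    by (simp add: summable_on_reindex[OF inj] o_def)
  assume nonneg: "\<And>i. 0 \<le> f i"
  have "(\<Sum>\<^sub>\<infinity>l. f (k - 2 * l)) = infsum f (range ?h)"
    by (simp add: infsum_reindex[OF inj] o_def)
  also have "\<dots> \<le> infsum f UNIV"
    by (rule infsum_mono2[OF sub assms]) (use nonneg in auto)
  finally show "(\<Sum>\<^sub>\<infinity>l. f (k - 2 * l)) \<le> (\<Sum>\<^sub>\<infinity>i. f i)" .
qed

text \<open>The first moment of \<open>\<gamma>\<close> enters with a factor two because the entry \<open>l - m\<close> of the downsampled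
  sequence sits at position \<open>2l - 2m\<close> of \<open>c\<close>.\<close>

lemma coarsen_deviation:
  assumes c: "c \<in> linf" and \<gamma>: "\<gamma> \<in> l1" "(\<Sum>\<^sub>\<infinity>k. \<gamma> k) = 1"
    and moment: "(\<lambda>k. \<bar>\<gamma> k\<bar> * \<bar>real_of_int k\<bar>) summable_on UNIV"
  shows "\<bar>c k - conv \<gamma> (downsample c) l\<bar>
    \<le> (real_of_int \<bar>k - 2 * l\<bar> * l1_norm \<gamma> + 2 * (\<Sum>\<^sub>\<infinity>k. \<bar>\<gamma> k\<bar> * \<bar>real_of_int k\<bar>))
        * linf_norm (diff_op c)"
proof -
  define D where "D = linf_norm (diff_op c)"
  define r where "r = real_of_int \<bar>k - 2 * l\<bar>"
  define B where "B m = (r + 2 * \<bar>real_of_int m\<bar>) * D" for m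
  have D0: "0 \<le> D"
    unfolding D_def by (rule linf_norm_nonneg[OF diff_op_in_linf[OF c]])
  have abs: "(\<lambda>m. \<bar>\<gamma> m\<bar>) summable_on UNIV"
    using \<gamma>(1) by (simp add: l1_def)
  have split: "(\<lambda>m. \<bar>\<gamma> m\<bar> * B m) = (\<lambda>m. r * D * \<bar>\<gamma> m\<bar> + 2 * D * (\<bar>\<gamma> m\<bar> * \<bar>real_of_int m\<bar>))"
    by (simp add: B_def algebra_simps)
  have s1: "(\<lambda>m. r * D * \<bar>\<gamma> m\<bar>) summable_on UNIV"
    by (rule summable_on_cmult_right[OF abs])
  have s2: "(\<lambda>m. 2 * D * (\<bar>\<gamma> m\<bar> * \<bar>real_of_int m\<bar>)) summable_on UNIV"
    by (rule summable_on_cmult_right[OF moment])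
  have near: "\<bar>c k - downsample c (l - m)\<bar> \<le> B m" for m
  proof -
    have "\<bar>c k - downsample c (l - m)\<bar> \<le> real_of_int \<bar>k - 2 * (l - m)\<bar> * D"
      unfolding downsample_def D_def by (rule abs_diff_le_linf_norm_diff_op[OF c])
    also have "\<dots> \<le> B m"
      unfolding B_def r_def
    proof (rule mult_right_mono[OF _ D0])
      have "k - 2 * (l - m) = (k - 2 * l) + 2 * m"
        by simp
      then have "\<bar>k - 2 * (l - m)\<bar> \<le> \<bar>k - 2 * l\<bar> + \<bar>2 * m\<bar>"
        using abs_triangle_ineq[of "k - 2 * l" "2 * m"] by (simp only:)
      then have "real_of_int \<bar>k - 2 * (l - m)\<bar> \<le> real_of_int (\<bar>k - 2 * l\<bar> + \<bar>2 * m\<bar>)"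
        by (simp only: of_int_le_iff)
      then show "real_of_int \<bar>k - 2 * (l - m)\<bar> \<le> real_of_int \<bar>k - 2 * l\<bar> + 2 * \<bar>real_of_int m\<bar>"
        by (simp only: of_int_add of_int_abs of_int_mult of_int_numeral abs_mult abs_numeral)
    qed
    finally show ?thesis .
  qed
  have "\<bar>c k - conv \<gamma> (downsample c) l\<bar> \<le> (\<Sum>\<^sub>\<infinity>m. \<bar>\<gamma> m\<bar> * B m)"
    unfolding conv_def
  proof (rule average_deviation_bound[OF _ \<gamma>(2)])
    show "\<gamma> summable_on UNIV"
      by (rule abs_summable_summable) (simp add: abs)
    show "(\<lambda>m. \<bar>\<gamma> m\<bar> * B m) summable_on UNIV"
      unfolding split by (rule summable_on_add[OF s1 s2])
  qed (rule near)
  also have "\<dots> = r * D * l1_norm \<gamma> + 2 * D * (\<Sum>\<^sub>\<infinity>k. \<bar>\<gamma> k\<bar> * \<bar>real_of_int k\<bar>)"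
    unfolding split l1_norm_def
    by (simp add: infsum_add[OF s1 s2] infsum_cmult_right[OF abs] infsum_cmult_right[OF moment])
  finally show ?thesis
    by (simp add: r_def D_def algebra_simps)
qed

text \<open>The averaging estimate for the weights \<open>\<alpha> (k - 2l)\<close>.  Its bound depends on \<open>l\<close> only through
  \<open>k - 2l\<close>, so the sum over one coset can be enlarged to a sum over all entries of \<open>\<alpha>\<close>.\<close>

lemma detail_abs_le:
  assumes c: "c \<in> linf" and \<alpha>: "\<alpha> \<in> l1" and \<gamma>: "\<gamma> \<in> l1" "(\<Sum>\<^sub>\<infinity>k. \<gamma> k) = 1"
    and cosets: "(\<Sum>\<^sub>\<infinity>k. \<alpha> (2 * k)) = 1" "(\<Sum>\<^sub>\<infinity>k. \<alpha> (2 * k + 1)) = 1"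
    and m\<alpha>: "(\<lambda>k. \<bar>\<alpha> k\<bar> * \<bar>real_of_int k\<bar>) summable_on UNIV"
    and m\<gamma>: "(\<lambda>k. \<bar>\<gamma> k\<bar> * \<bar>real_of_int k\<bar>) summable_on UNIV"
  shows "\<bar>c k - subdiv \<alpha> (conv \<gamma> (downsample c)) k\<bar>
    \<le> (2 * (\<Sum>\<^sub>\<infinity>k. \<bar>\<gamma> k\<bar> * \<bar>real_of_int k\<bar>) * l1_norm \<alpha>
        + (\<Sum>\<^sub>\<infinity>k. \<bar>\<alpha> k\<bar> * \<bar>real_of_int k\<bar>) * l1_norm \<gamma>) * linf_norm (diff_op c)"
proof -
  define D where "D = linf_norm (diff_op c)"
  define G where "G = 2 * (\<Sum>\<^sub>\<infinity>k. \<bar>\<gamma> k\<bar> * \<bar>real_of_int k\<bar>)"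
  define B where "B i = (\<bar>real_of_int i\<bar> * l1_norm \<gamma> + G) * D" for i
  have D0: "0 \<le> D"
    unfolding D_def by (rule linf_norm_nonneg[OF diff_op_in_linf[OF c]])
  have B0: "0 \<le> B i" for i
    unfolding B_def G_def l1_norm_def
    by (intro mult_nonneg_nonneg add_nonneg_nonneg infsum_nonneg D0) auto
  have abs: "(\<lambda>i. \<bar>\<alpha> i\<bar>) summable_on UNIV"
    using \<alpha> by (simp add: l1_def)
  have split: "(\<lambda>i. \<bar>\<alpha> i\<bar> * B i)
      = (\<lambda>i. l1_norm \<gamma> * D * (\<bar>\<alpha> i\<bar> * \<bar>real_of_int i\<bar>) + G * D * \<bar>\<alpha> i\<bar>)"
    by (simp add: B_def algebra_simps)
  have s1: "(\<lambda>i. l1_norm \<gamma> * D * (\<bar>\<alpha> i\<bar> * \<bar>real_of_int i\<bar>)) summable_on UNIV"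
    by (rule summable_on_cmult_right[OF m\<alpha>])
  have s2: "(\<lambda>i. G * D * \<bar>\<alpha> i\<bar>) summable_on UNIV"
    by (rule summable_on_cmult_right[OF abs])
  have \<alpha>B: "(\<lambda>i. \<bar>\<alpha> i\<bar> * B i) summable_on UNIV"
    unfolding split by (rule summable_on_add[OF s1 s2])
  have "\<bar>c k - subdiv \<alpha> (conv \<gamma> (downsample c)) k\<bar> \<le> (\<Sum>\<^sub>\<infinity>l. \<bar>\<alpha> (k - 2 * l)\<bar> * B (k - 2 * l))"
    unfolding subdiv_def
  proof (rule average_deviation_bound[OF _ infsum_coset_eq_1[OF cosets]])
    show "(\<lambda>l. \<alpha> (k - 2 * l)) summable_on UNIV"
      by (rule summable_on_coset, rule abs_summable_summable) (simp add: abs)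
    show "(\<lambda>l. \<bar>\<alpha> (k - 2 * l)\<bar> * B (k - 2 * l)) summable_on UNIV"
      by (rule summable_on_coset[OF \<alpha>B])
    show "\<bar>c k - conv \<gamma> (downsample c) l\<bar> \<le> B (k - 2 * l)" for l
      using coarsen_deviation[OF c \<gamma> m\<gamma>, of k l] by (simp add: B_def G_def D_def)
  qed
  also have "\<dots> \<le> (\<Sum>\<^sub>\<infinity>i. \<bar>\<alpha> i\<bar> * B i)"
    by (rule infsum_coset_le[OF \<alpha>B]) (simp add: B0)
  also have "\<dots> = l1_norm \<gamma> * D * (\<Sum>\<^sub>\<infinity>k. \<bar>\<alpha> k\<bar> * \<bar>real_of_int k\<bar>) + G * D * l1_norm \<alpha>"
    unfolding split infsum_add[OF s1 s2]
    by (simp add: infsum_cmult_right[OF abs] infsum_cmult_right[OF m\<alpha>] l1_norm_def[of \<alpha>])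
  finally show ?thesis
    by (simp add: D_def G_def algebra_simps)
qed

section \<open>Descending the pyramid\<close>

lemma pyramid_in_linf:
  fixes c :: "nat \<Rightarrow> bi_seq"
  assumes "\<gamma> \<in> l1" "c j \<in> linf"
    and "\<And>l. 1 \<le> l \<Longrightarrow> l \<le> j \<Longrightarrow> c (l - 1) = conv \<gamma> (downsample (c l))"
    and "l \<le> j"
  shows "c l \<in> linf"
  using \<open>l \<le> j\<close>
proof (induction l rule: inc_induct)
  case (step n)
  have "c n = conv \<gamma> (downsample (c (Suc n)))"
    using assms(3)[of "Suc n"] step.hyps by simp
  then show ?case
    using conv_in_linf[OF assms(1) downsample_in_linf[OF step.IH]] by simp
qed (rule assms(2))

lemma pyramid_linf_norm_diff_op_le:
  fixes c :: "nat \<Rightarrow> bi_seq"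
  assumes "\<gamma> \<in> l1" "c j \<in> linf"
    and coarsen: "\<And>l. 1 \<le> l \<Longrightarrow> l \<le> j \<Longrightarrow> c (l - 1) = conv \<gamma> (downsample (c l))"
    and "l \<le> j"
  shows "linf_norm (diff_op (c l)) \<le> (2 * l1_norm \<gamma>) ^ (j - l) * linf_norm (diff_op (c j))"
  using \<open>l \<le> j\<close>
proof (induction l rule: inc_induct)
  case (step n)
  have "c (Suc n) \<in> linf"
    by (rule pyramid_in_linf[where c = c and j = j, OF assms(1-3)]) (use step.hyps in simp_all)
  moreover have "c n = conv \<gamma> (downsample (c (Suc n)))"
    using coarsen[of "Suc n"] step.hyps by simp
  ultimately have "linf_norm (diff_op (c n)) \<le> 2 * l1_norm \<gamma> * linf_norm (diff_op (c (Suc n)))"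
    using linf_norm_diff_op_coarsen_le[OF assms(1)] by simp
  also have "\<dots> \<le> 2 * l1_norm \<gamma> * ((2 * l1_norm \<gamma>) ^ (j - Suc n) * linf_norm (diff_op (c j)))"
    by (rule mult_left_mono[OF step.IH]) (simp add: l1_norm_def infsum_nonneg)
  also have "\<dots> = (2 * l1_norm \<gamma>) ^ (j - n) * linf_norm (diff_op (c j))"
    unfolding Suc_diff_Suc[OF step.hyps(2), symmetric] power_Suc by (simp only: mult.assoc)
  finally show ?case .
qed simp

theorem theorem8:
  fixes j :: nat
    and c d :: "nat \<Rightarrow> bi_seq"
    and \<alpha> \<gamma> :: bi_seq
    and K\<alpha> K\<gamma> K\<alpha>\<gamma> :: real
  assumes "j \<ge> 1"
    and "c j \<in> linf"
    and "\<alpha> \<in> l1" and "\<gamma> \<in> l1"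
    and "(\<Sum>\<^sub>\<infinity>k. \<alpha> (2 * k)) = 1"
    and "(\<Sum>\<^sub>\<infinity>k. \<alpha> (2 * k + 1)) = 1"
    and "(\<Sum>\<^sub>\<infinity>k. \<gamma> k) = 1"
    and "(\<lambda>k. \<bar>\<alpha> k\<bar> * \<bar>real_of_int k\<bar>) summable_on UNIV"
    and "(\<Sum>\<^sub>\<infinity>k. \<bar>\<alpha> k\<bar> * \<bar>real_of_int k\<bar>) = K\<alpha>"
    and "(\<lambda>k. \<bar>\<gamma> k\<bar> * \<bar>real_of_int k\<bar>) summable_on UNIV"
    and "2 * (\<Sum>\<^sub>\<infinity>k. \<bar>\<gamma> k\<bar> * \<bar>real_of_int k\<bar>) = K\<gamma>"
    and "K\<alpha>\<gamma> = K\<gamma> * l1_norm \<alpha> + K\<alpha> * l1_norm \<gamma>"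
    and "\<And>l. 1 \<le> l \<Longrightarrow> l \<le> j \<Longrightarrow> c (l - 1) = conv \<gamma> (downsample (c l))"
    and "\<And>l. 1 \<le> l \<Longrightarrow> l \<le> j \<Longrightarrow> d l = (\<lambda>k. c l k - subdiv \<alpha> (c (l - 1)) k)"
  shows "(\<forall>l. 1 \<le> l \<and> l \<le> j \<longrightarrow>
            c l \<in> linf \<and> d l \<in> linf \<and>
            linf_norm (d l) \<le> K\<alpha>\<gamma> * linf_norm (diff_op (c l)))
       \<and> (\<forall>K::real. linf_norm (diff_op (c j)) \<le> K * 2 powi (- int j) \<longrightarrow>
            (\<forall>l. 1 \<le> l \<and> l \<le> j \<longrightarrow>
              linf_norm (d l) \<le> (K * K\<alpha>\<gamma> * l1_norm \<gamma> ^ j) * (2 * l1_norm \<gamma>) powi (- int l)))"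
proof (rule conjI)
  have K0: "0 \<le> K\<alpha>\<gamma>"
  proof -
    have "0 \<le> K\<alpha>" "0 \<le> K\<gamma>"
      unfolding assms(9,11)[symmetric] by (auto intro!: infsum_nonneg mult_nonneg_nonneg)
    then show ?thesis
      unfolding assms(12) l1_norm_def
      by (intro add_nonneg_nonneg mult_nonneg_nonneg infsum_nonneg) auto
  qed
  have in_linf: "c l \<in> linf" if "l \<le> j" for l
    by (rule pyramid_in_linf[where c = c and j = j, OF assms(4,2,13) that])
  have detail: "\<bar>d l k\<bar> \<le> K\<alpha>\<gamma> * linf_norm (diff_op (c l))" if "1 \<le> l" "l \<le> j" for l k
    using detail_abs_le[OF in_linf[OF that(2)] assms(3,4,7,5,6,8,10), of k]
    unfolding assms(14)[OF that] assms(13)[OF that] assms(9,11,12) .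
  show main: "\<forall>l. 1 \<le> l \<and> l \<le> j \<longrightarrow>
      c l \<in> linf \<and> d l \<in> linf \<and> linf_norm (d l) \<le> K\<alpha>\<gamma> * linf_norm (diff_op (c l))"
    using in_linf linfI[of "d _", OF detail] linf_norm_le[of "d _", OF detail] by simp
  show "\<forall>K. linf_norm (diff_op (c j)) \<le> K * 2 powi (- int j) \<longrightarrow>
      (\<forall>l. 1 \<le> l \<and> l \<le> j \<longrightarrow>
        linf_norm (d l) \<le> (K * K\<alpha>\<gamma> * l1_norm \<gamma> ^ j) * (2 * l1_norm \<gamma>) powi (- int l))"
  proof (intro allI impI)
    fix K l
    assume K: "linf_norm (diff_op (c j)) \<le> K * 2 powi (- int j)" and l: "1 \<le> l \<and> l \<le> j"
    (* The inverse powers below need a nonzero norm; here the mass one of \<gamma> gives at least 1. *)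
    have "\<bar>\<Sum>\<^sub>\<infinity>k. \<gamma> k\<bar> \<le> l1_norm \<gamma>"
      using norm_infsum_bound[of \<gamma> UNIV] assms(4) by (simp add: l1_norm_def l1_def)
    then have g: "1 \<le> l1_norm \<gamma>"
      using assms(7) by simp
    have "linf_norm (d l) \<le> K\<alpha>\<gamma> * linf_norm (diff_op (c l))"
      using main l by blast
    also have "\<dots> \<le> K\<alpha>\<gamma> * ((2 * l1_norm \<gamma>) ^ (j - l) * linf_norm (diff_op (c j)))"
      by (rule mult_left_mono[OF pyramid_linf_norm_diff_op_le[where c = c and j = j] K0])
        (use assms(2,4,13) l in auto)
    also have "\<dots> \<le> K\<alpha>\<gamma> * ((2 * l1_norm \<gamma>) ^ (j - l) * (K * 2 powi (- int j)))"
      by (intro mult_left_mono K K0 zero_le_power) (use g in simp_all)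
    also have "\<dots> = (K * K\<alpha>\<gamma> * l1_norm \<gamma> ^ j) * (2 * l1_norm \<gamma>) powi (- int l)"
    proof -
      have "(2 * l1_norm \<gamma>) ^ (j - l) = (2 * l1_norm \<gamma>) ^ j * (2 * l1_norm \<gamma>) powi (- int l)"
        using l g by (simp add: power_int_minus power_diff divide_inverse)
      moreover have "(2 * l1_norm \<gamma>) ^ j * 2 powi (- int j) = l1_norm \<gamma> ^ j"
        by (simp add: power_int_minus power_mult_distrib)
      ultimately show ?thesis
        by (metis (no_types, opaque_lifting) mult.assoc mult.commute)
    qed
    finally show "linf_norm (d l)
        \<le> (K * K\<alpha>\<gamma> * l1_norm \<gamma> ^ j) * (2 * l1_norm \<gamma>) powi (- int l)" .
  qed
qed

end
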